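(* Let $n,m\in\mathbb{N}$ with $0<m<n$, and let $f_{3n}\in\mathcal{V}_{3n}^m$ be decomposed as $f_{3n}=f_n+g_{2n}$ with $f_n\in\mathcal{V}_n^m$ and $g_{2n}\in\mathcal{W}_n^m$. Let the row vectors $\vec a_n^\bot=(a_0^\bot,\ldots,a_{n-1}^\bot)$, $\vec b_{2n}^\bot=(b_n^\bot,\ldots,b_{3n-1}^\bot)$ and $\vec a_{3n}^\bot\in\mathbb{R}^{3n}$ be the coefficient vectors of $f_n$, $g_{2n}$ and $f_{3n}$ with respect to the orthogonal bases $\{\Phi_{n,k}^{m,\bot}\}_{k=0}^{n-1}$ of $\mathcal{V}_n^m$, $\{\psi_{n,k}^{m,\bot}\}_{k=n}^{3n-1}$ of $\mathcal{W}_n^m$ and $\{\Phi_{3n,j}^{m,\bot}\}_{j=0}^{3n-1}$ of $\mathcal{V}_{3n}^m$, respectively. Then the decomposition and reconstruction formulas are $$(\vec a_n^\bot,\ \vec b_{2n}^\bot)=\vec a_{3n}^\bot M^{-1}\qquad\text{and}\qquad \vec a_{3n}^\bot=(\vec a_n^\bot,\ \vec b_{2n}^\bot)\,M,$$ where the matrix $M\in\mathbb{R}^{3n\times3n}$ and its inverse $M^{-1}$ have the following entries at row $k+1$ and column $j+1$, for $k,j=0,\ldots,3n-1$: $$M_{k,j}=\frac1{\nu_{3n,j}}\begin{cases}s_{k,j}, & 0\le k<n,\\ w_{k,j}, & n\le k<3n,\end{cases}\qquad (M^{-1})_{k,j}=\begin{cases}\dfrac{s_{j,k}}{\nu_{n,j}},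 & 0\le j<n,\\[2mm] \dfrac{w_{j,k}}{\mathrm{v}_{n,j}}, & n\le j<3n.\end{cases}$$ Here $s_{k,j}=\langle\Phi_{n,k}^{m,\bot},\Phi_{3n,j}^{m,\bot}\rangle_{L^2_w}$ for $0\le k\le n-1$, $0\le j\le3n-1$; $w_{k,j}=\langle\psi_{n,k}^{m,\bot},\Phi_{3n,j}^{m,\bot}\rangle_{L^2_w}$ for $n\le k\le3n-1$, $0\le j\le3n-1$; $\nu_{N,j}=\|\Phi_{N,j}^{m,\bot}\|_2^2$ for $N\in\{n,3n\}$; and $\mathrm{v}_{n,j}=\|\psi_{n,j}^{m,\bot}\|_2^2$.
   Context: Let $w(x)=1/\sqrt{1-x^2}$ on $[-1,1]$, $\langle f,g\rangle_{L^2_w}=\int_{-1}^1f(x)g(x)w(x)\,dx$, $\|f\|_2^2=\langle f,f\rangle_{L^2_w}$. Orthonormal Chebyshev polynomials: $p_0=\sqrt{1/\pi}$, $p_r(x)=\sqrt{2/\pi}\cos(r\arccos x)$ for $r>0$. For integers $0<m<N$ put $\mu_{N,r}^m=1$ if $0\le r\le N-m$, $\mu_{N,r}^m=\frac{m+N-r}{2m}$ if $N-m<r<N+m$, and $\mu_{N,r}^m=0$ otherwise. With $x_k^N=\cos\frac{(2k-1)\pi}{2N}$, the space $\mathcal{V}_N^m$ is the $N$-dimensional span of the polynomials $\Phi_{N,k}^m(x)=\frac{\pi}{N}\sum_{r=0}^{N+m-1}\mu_{N,r}^mp_r(x_k^N)p_r(x)$, $k=1,\ldots,N$. An orthogonal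 basis of $\mathcal{V}_N^m$ is $$\Phi_{N,r}^{m,\bot}(x)=\begin{cases}p_r(x), & 0\le r\le N-m,\\ \mu_{N,r}^mp_r(x)-\mu_{N,2N-r}^mp_{2N-r}(x), & N-m<r<N,\end{cases}\qquad r=0,\ldots,N-1,$$ with $\nu_{N,r}=\|\Phi_{N,r}^{m,\bot}\|_2^2=1$ if $0\le r\le N-m$ and $\frac{m^2+(N-r)^2}{2m^2}$ if $N-m<r<N$. One has $\mathcal{V}_n^m\subset\mathcal{V}_{3n}^m$, and $\mathcal{W}_n^m$ is the orthogonal complement of $\mathcal{V}_n^m$ in $\mathcal{V}_{3n}^m$ (dimension $2n$). An orthogonal basis of $\mathcal{W}_n^m$ is given, for $r=n,\ldots,3n-1$, by $$\psi_{n,r}^{m,\bot}(x)=\begin{cases}\mu_{n,r}^mp_{2n-r}(x)+\mu_{n,2n-r}^mp_r(x), & n\le r<n+m,\\ p_r(x), & n+m\le r\le3n-m,\\ \Phi_{3n,r}^{m,\bot}(x), & 3n-m<r<3n,\end{cases}$$ with $\mathrm{v}_{n,r}=\|\psi_{n,r}^{m,\bot}\|_2^2$ equal to $\frac{m^2+(n-r)^2}{2m^2}$ if $n<r<n+m$, to $1$ if $r=n$ or $n+m\le r\le3n-m$, and to $\frac{m^2+(3n-r)^2}{2m^2}$ if $3n-m<r<3n$. *)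

theory Defs
  imports "HOL-Analysis.Analysis" "HOL-Computational_Algebra.Polynomial" "Jordan_Normal_Form.Matrix"
begin

text \<open>
  All functions involved are polynomials on \<open>[-1, 1]\<close>; they are represented by the type
  \<open>real poly\<close>, so that equality of functions on \<open>[-1, 1]\<close> is equality of terms.
\<close>

definition cheb_inner :: "real poly \<Rightarrow> real poly \<Rightarrow> real" where
  "cheb_inner f g = (LINT x:{-1..1}|lborel. poly f x * poly g x * (1 / sqrt (1 - x\<^sup>2)))"

definition cheb_norm_sq :: "real poly \<Rightarrow> real" where
  "cheb_norm_sq f = cheb_inner f f"

definition cheb_p :: "nat \<Rightarrow> real poly" where
  "cheb_p r = (THE P. \<forall>x\<in>{-1..1}. poly P x =
     (if r = 0 then sqrt (1 / pi) else sqrt (2 / pi) * cos (real r * arccos x)))"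

text \<open>The definite description above is well-defined:\<close>

lemma ex_cheb: "\<exists>P. \<forall>x\<in>{-1..1}. poly P x = cos (real r * arccos x)"
proof (induction r rule: less_induct)
  case (less r)
  consider "r = 0" | "r = 1" | k where "r = Suc (Suc k)"
    by (metis One_nat_def not0_implies_Suc)
  then show ?case
  proof cases
    case 1
    then show ?thesis by (intro exI[of _ 1]) auto
  next
    case 2
    then show ?thesis by (intro exI[of _ "[:0, 1:]"]) auto
  next
    case 3
    obtain P where P: "\<forall>x\<in>{-1..1}. poly P x = cos (real (Suc k) * arccos x)"
      using less[of "Suc k"] 3 by auto
    obtain Q where Q: "\<forall>x\<in>{-1..1}. poly Q x = cos (real k * arccos x)"
      using less[of k] 3 by auto
    have "poly ([:0, 2:] * P - Q) x = cos (real r * arccos x)" if x: "x \<in> {-1..1}" for x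
    proof -
      define t where "t = arccos x"
      have t: "cos t = x" using x by (simp add: t_def)
      have "cos (real r * t) + cos (real k * t) = 2 * cos t * cos (real (Suc k) * t)"
      proof -
        have sum: "cos (u + v) + cos (u - v) = 2 * cos v * cos u" for u v :: real
          by (simp add: cos_add cos_diff)
        have "real r * t = real (Suc k) * t + t" "real k * t = real (Suc k) * t - t"
          using 3 by (simp_all add: algebra_simps)
        then show ?thesis by (simp only: sum)
      qed
      then show ?thesis using P Q x t by (simp add: t_def algebra_simps)
    qed
    then show ?thesis by blast
  qed
qed

lemma poly_cheb_p:
  assumes "x \<in> {-1..1}"
  shows "poly (cheb_p r) x =
    (if r = 0 then sqrt (1 / pi) else sqrt (2 / pi) * cos (real r * arccos x))"
proof -
  define h where "h = (\<lambda>x. if r = 0 then sqrt (1 / pi) else sqrt (2 / pi) * cos (real r * arccos x))"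
  have "\<exists>!P. \<forall>x\<in>{-1..1}. poly P x = h x"
  proof (rule ex_ex1I)
    show "\<exists>P. \<forall>x\<in>{-1..1}. poly P x = h x"
    proof -
      obtain Q where Q: "\<forall>x\<in>{-1..1}. poly Q x = cos (real r * arccos x)"
        using ex_cheb by blast
      have "\<forall>x\<in>{-1..1}. poly (if r = 0 then [:sqrt (1 / pi):]
          else Polynomial.smult (sqrt (2 / pi)) Q) x = h x"
        using Q by (auto simp: h_def)
      then show ?thesis by blast
    qed
  next
    fix P Q :: "real poly"
    assume P: "\<forall>x\<in>{-1..1}. poly P x = h x" and Q: "\<forall>x\<in>{-1..1}. poly Q x = h x"
    have "{-1..1::real} \<subseteq> {x. poly (P - Q) x = 0}" using P Q by auto
    moreover have "infinite {-1..1::real}" by (rule infinite_Icc) simp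
    ultimately have "P - Q = 0" using poly_roots_finite[of "P - Q"] finite_subset by blast
    then show "P = Q" by simp
  qed
  from theI'[OF this] have "\<forall>x\<in>{-1..1}. poly (cheb_p r) x = h x"
    unfolding cheb_p_def h_def by simp
  then show ?thesis using assms by (simp add: h_def)
qed

definition vp_mu :: "nat \<Rightarrow> nat \<Rightarrow> nat \<Rightarrow> real" where
  "vp_mu N m r =
     (if r \<le> N - m then 1
      else if r < N + m then (real m + real N - real r) / (2 * real m)
      else 0)"

definition cheb_node :: "nat \<Rightarrow> nat \<Rightarrow> real" where
  "cheb_node N k = cos ((2 * real k - 1) * pi / (2 * real N))"

definition vp_Phi :: "nat \<Rightarrow> nat \<Rightarrow> nat \<Rightarrow> real poly" where
  "vp_Phi N m k = Polynomial.smult (pi / real N)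
     (\<Sum>r = 0..N + m - 1.
        Polynomial.smult (vp_mu N m r * poly (cheb_p r) (cheb_node N k)) (cheb_p r))"

definition vp_V :: "nat \<Rightarrow> nat \<Rightarrow> real poly set" where
  "vp_V N m = Modules.module.span Polynomial.smult (vp_Phi N m ` {1..N})"

definition vp_W :: "nat \<Rightarrow> nat \<Rightarrow> real poly set" where
  "vp_W n m = {g \<in> vp_V (3 * n) m. \<forall>h \<in> vp_V n m. cheb_inner g h = 0}"

definition Phi_orth :: "nat \<Rightarrow> nat \<Rightarrow> nat \<Rightarrow> real poly" where
  "Phi_orth N m r =
     (if r \<le> N - m then cheb_p r
      else Polynomial.smult (vp_mu N m r) (cheb_p r)
         - Polynomial.smult (vp_mu N m (2 * N - r)) (cheb_p (2 * N - r)))"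

text \<open>The orthogonal basis of \<open>vp_W n m\<close>, indexed by \<open>n \<le> r < 3 * n\<close>.\<close>

definition psi_orth :: "nat \<Rightarrow> nat \<Rightarrow> nat \<Rightarrow> real poly" where
  "psi_orth n m r =
     (if r < n + m then Polynomial.smult (vp_mu n m r) (cheb_p (2 * n - r))
         + Polynomial.smult (vp_mu n m (2 * n - r)) (cheb_p r)
      else if r \<le> 3 * n - m then cheb_p r
      else Phi_orth (3 * n) m r)"

definition nu :: "nat \<Rightarrow> nat \<Rightarrow> nat \<Rightarrow> real" where
  "nu N m j = cheb_norm_sq (Phi_orth N m j)"

definition v_norm :: "nat \<Rightarrow> nat \<Rightarrow> nat \<Rightarrow> real" where
  "v_norm n m j = cheb_norm_sq (psi_orth n m j)"

definition s_entry :: "nat \<Rightarrow> nat \<Rightarrow> nat \<Rightarrow> nat \<Rightarrow> real" where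
  "s_entry n m k j = cheb_inner (Phi_orth n m k) (Phi_orth (3 * n) m j)"

definition w_entry :: "nat \<Rightarrow> nat \<Rightarrow> nat \<Rightarrow> nat \<Rightarrow> real" where
  "w_entry n m k j = cheb_inner (psi_orth n m k) (Phi_orth (3 * n) m j)"

definition mat_M :: "nat \<Rightarrow> nat \<Rightarrow> real mat" where
  "mat_M n m = mat (3 * n) (3 * n)
     (\<lambda>(k, j). 1 / nu (3 * n) m j * (if k < n then s_entry n m k j else w_entry n m k j))"

definition mat_M_inv :: "nat \<Rightarrow> nat \<Rightarrow> real mat" where
  "mat_M_inv n m = mat (3 * n) (3 * n)
     (\<lambda>(k, j). if j < n then s_entry n m j k / nu n m j else w_entry n m j k / v_norm n m j)"

text \<open>Keep \<open>$\<close> for the entries of \<open>real vec\<close> from the matrix library.\<close>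

unbundle no vec_syntax

end

theory Submission
  imports Defs "Jordan_Normal_Form.Determinant"
begin

text \<open>
  Expanding an element of one orthogonal family in another one and pairing with the second family
  yields the entries of \<^term>\<open>mat_M n m\<close>; pairing the expansion with the first family gives
  \<open>M * M\<^sup>-\<^sup>1 = 1\<close>, and the other product follows because the matrices are square. What remains
  is the orthonormality of the Chebyshev polynomials, for which \<open>- sin (k arccos x) / k\<close> serves
  as antiderivative of \<open>cos (k arccos x) / sqrt (1 - x\<^sup>2)\<close>, and the observation that for
  \<open>r \<le> 3n - m\<close> the basis element \<^term>\<open>Phi_orth (3 * n) m r\<close> is \<^term>\<open>cheb_p r\<close> itself, while
  \<^term>\<open>Phi_orth n m r\<close> and, for \<open>r < n + m\<close>, \<^term>\<open>psi_orth n m r\<close> involve only indices below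
  \<open>n + m \<le> 3n - m\<close>.
\<close>

section \<open>The weighted inner product and its bilinearity\<close>

text \<open>The weight is the derivative of \<open>arcsin\<close>, which is continuous up to the
  endpoints, so its singularities there are integrable. A continuous factor is bounded on the
  compact interval and preserves this.\<close>

lemma cheb_weight_set_integrable:
  fixes f :: "real \<Rightarrow> real"
  assumes "continuous_on {-1..1} f"
  shows "set_integrable lborel {-1..1} (\<lambda>x. f x * (1 / sqrt (1 - x\<^sup>2)))"
proof -
  define w :: "real \<Rightarrow> real" where "w = (\<lambda>x. 1 / sqrt (1 - x\<^sup>2))"
  have "(w has_integral (arcsin 1 - arcsin (-1))) {-1..1}"
    unfolding w_def
  proof (rule fundamental_theorem_of_calculus_interior)
    show "continuous_on {-1..1} arcsin" by (rule continuous_on_arcsin')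
    fix x :: real assume "x \<in> {-1<..<1}"
    then show "(arcsin has_vector_derivative 1 / sqrt (1 - x\<^sup>2)) (at x)"
      using DERIV_arcsin[of x]
      by (simp add: has_real_derivative_iff_has_vector_derivative inverse_eq_divide)
  qed simp
  moreover have "0 \<le> w x" if "x \<in> {-1..1}" for x
    using that by (auto simp: w_def abs_le_iff abs_square_le_1)
  ultimately have "w absolutely_integrable_on {-1..1}"
    by (intro nonnegative_absolutely_integrable_1) (auto simp: integrable_on_def)
  \<comment> \<open>\<open>absolutely_integrable_on\<close> refers to the completed measure; Borel
    measurability of the weight brings integrability down to \<open>lborel\<close>.\<close>
  then have w: "set_integrable lborel {-1..1} w"
    unfolding set_integrable_def w_def by (subst (asm) integrable_completion) measurable
  obtain B where B: "\<forall>x\<in>{-1..1}. \<bar>f x\<bar> \<le> B"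
    using compact_imp_bounded[OF compact_continuous_image[OF assms compact_Icc]]
    by (auto simp: bounded_iff)
  have meas: "(\<lambda>x. indicator {-1..1} x * f x) \<in> borel_measurable borel"
    using borel_measurable_continuous_on_indicator[OF _ assms] by simp
  show ?thesis
    unfolding set_integrable_def
  proof (rule Bochner_Integration.integrable_bound)
    show "integrable lborel (\<lambda>x. B * (indicator {-1..1} x *\<^sub>R w x))"
      using w by (simp add: set_integrable_def)
    have "(\<lambda>x. (indicator {-1..1} x * f x) * (1 / sqrt (1 - x\<^sup>2))) \<in> borel_measurable borel"
      using meas by measurable
    then show "(\<lambda>x. indicator {-1..1} x *\<^sub>R (f x * (1 / sqrt (1 - x\<^sup>2))))
        \<in> borel_measurable lborel"
      by (simp add: mult.assoc)
    show "AE x in lborel. norm (indicator {-1..1} x *\<^sub>R (f x * (1 / sqrt (1 - x\<^sup>2))))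
        \<le> norm (B * (indicator {-1..1} x *\<^sub>R w x))"
    proof (rule AE_I2)
      fix x :: real
      show "norm (indicator {-1..1} x *\<^sub>R (f x * (1 / sqrt (1 - x\<^sup>2))))
          \<le> norm (B * (indicator {-1..1} x *\<^sub>R w x))"
      proof (cases "x \<in> {-1..1}")
        case True
        then have "\<bar>f x\<bar> \<le> \<bar>B\<bar>" using B by fastforce
        then have "\<bar>f x\<bar> * \<bar>w x\<bar> \<le> \<bar>B\<bar> * \<bar>w x\<bar>" by (rule mult_right_mono) simp
        then show ?thesis using True by (simp add: w_def abs_mult)
      qed simp
    qed
  qed
qed

lemma cheb_inner_commute: "cheb_inner f g = cheb_inner g f"
  by (simp add: cheb_inner_def mult.commute)

text \<open>Supplies the integrability of both summands on which additivity of the integral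
  rests.\<close>

lemma cheb_inner_set_integrable:
  "set_integrable lborel {-1..1} (\<lambda>x. poly f x * poly g x * (1 / sqrt (1 - x\<^sup>2)))"
  by (intro cheb_weight_set_integrable continuous_intros)

lemma cheb_inner_add_left: "cheb_inner (f + g) h = cheb_inner f h + cheb_inner g h"
  using set_integral_add(2)[OF cheb_inner_set_integrable[of f h] cheb_inner_set_integrable[of g h]]
  by (simp add: cheb_inner_def algebra_simps add_divide_distrib)

lemma cheb_inner_smult_left: "cheb_inner (Polynomial.smult c f) h = c * cheb_inner f h"
proof -
  have "cheb_inner (Polynomial.smult c f) h
      = (LINT x:{-1..1}|lborel. c * (poly f x * poly h x * (1 / sqrt (1 - x\<^sup>2))))"
    by (simp add: cheb_inner_def mult.assoc)
  then show ?thesis unfolding cheb_inner_def by (simp only: set_integral_mult_right)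
qed

lemma cheb_inner_diff_left: "cheb_inner (f - g) h = cheb_inner f h - cheb_inner g h"
  using cheb_inner_add_left[of "f - g" g h] by simp

lemma cheb_inner_zero_left: "cheb_inner 0 h = 0"
  by (simp add: cheb_inner_def)

lemma cheb_inner_sum_left: "cheb_inner (sum f A) h = (\<Sum>i\<in>A. cheb_inner (f i) h)"
  by (induction A rule: infinite_finite_induct)
    (simp_all add: cheb_inner_zero_left cheb_inner_add_left)

lemma cheb_inner_add_right: "cheb_inner h (f + g) = cheb_inner h f + cheb_inner h g"
  using cheb_inner_add_left by (simp add: cheb_inner_commute[of h])

lemma cheb_inner_diff_right: "cheb_inner h (f - g) = cheb_inner h f - cheb_inner h g"
  using cheb_inner_diff_left by (simp add: cheb_inner_commute[of h])

lemma cheb_inner_smult_right: "cheb_inner h (Polynomial.smult c f) = c * cheb_inner h f"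
  using cheb_inner_smult_left by (simp add: cheb_inner_commute[of h])

lemmas cheb_inner_linear =
  cheb_inner_add_left cheb_inner_add_right cheb_inner_diff_left cheb_inner_diff_right
  cheb_inner_smult_left cheb_inner_smult_right

section \<open>Orthonormality of the Chebyshev polynomials\<close>

text \<open>An integer index covers both the difference and the sum of degrees that a product of two
  cosines produces.\<close>

lemma integral_cos_arccos:
  fixes k :: int
  shows "(LINT x:{-1..1}|lborel. cos (of_int k * arccos x) * (1 / sqrt (1 - x\<^sup>2)))
    = (if k = 0 then pi else 0)"
proof -
  define F :: "real \<Rightarrow> real" where
    "F = (\<lambda>x. if k = 0 then - arccos x else - sin (of_int k * arccos x) / of_int k)"
  have "((\<lambda>x. cos (of_int k * arccos x) * (1 / sqrt (1 - x\<^sup>2))) has_integral F 1 - F (-1)) {-1..1}"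
  proof (rule fundamental_theorem_of_calculus_interior)
    show "continuous_on {-1..1} F"
      unfolding F_def by (cases "k = 0") (auto intro!: continuous_intros continuous_on_arccos')
    fix x :: real assume "x \<in> {-1<..<1}"
    then have "(F has_real_derivative cos (of_int k * arccos x) * (1 / sqrt (1 - x\<^sup>2))) (at x)"
      unfolding F_def
      by (cases "k = 0") (auto intro!: derivative_eq_intros simp: field_simps)
    then show "(F has_vector_derivative cos (of_int k * arccos x) * (1 / sqrt (1 - x\<^sup>2))) (at x)"
      by (simp only: has_real_derivative_iff_has_vector_derivative)
  qed simp
  moreover have "F 1 - F (-1) = (if k = 0 then pi else 0)"
    \<comment> \<open>\<open>arccos\<close> is pi at -1 and 0 at 1, and the sine vanishes at integer
      multiples of pi.\<close>
    by (simp add: F_def sin_integer_2pi sin_int_times_real mult.commute)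
  moreover have "set_integrable lborel {-1..1} (\<lambda>x. cos (of_int k * arccos x) * (1 / sqrt (1 - x\<^sup>2)))"
    by (intro cheb_weight_set_integrable continuous_intros continuous_on_arccos')
  ultimately show ?thesis
    by (simp add: set_borel_integral_eq_integral(2) integral_unique)
qed

lemma cheb_p_orthonormal: "cheb_inner (cheb_p r) (cheb_p s) = (if r = s then 1 else 0)"
proof -
  define c :: "nat \<Rightarrow> real" where "c = (\<lambda>r. if r = 0 then sqrt (1 / pi) else sqrt (2 / pi))"
  let ?g = "\<lambda>k x. cos (real_of_int k * arccos x) * (1 / sqrt (1 - x\<^sup>2))"
  have p: "poly (cheb_p r) x = c r * cos (real r * arccos x)" if "x \<in> {-1..1}" for r x
    using poly_cheb_p[OF that] by (simp add: c_def)
  have int: "set_integrable lborel {-1..1} (?g k)" for k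
    by (intro cheb_weight_set_integrable continuous_intros continuous_on_arccos')
  have "poly (cheb_p r) x * poly (cheb_p s) x * (1 / sqrt (1 - x\<^sup>2))
      = c r * c s / 2 * (?g (int r - int s) x + ?g (int r + int s) x)" if "x \<in> {-1..1}" for x
  proof -
    have "cos (of_int (int r - int s) * t) + cos (of_int (int r + int s) * t)
        = 2 * (cos (real r * t) * cos (real s * t))" for t :: real
      by (simp add: cos_times_cos left_diff_distrib distrib_right)
    then show ?thesis
      unfolding p[OF that] distrib_right[symmetric] by simp
  qed
  then have "cheb_inner (cheb_p r) (cheb_p s)
      = (LINT x:{-1..1}|lborel. c r * c s / 2 * (?g (int r - int s) x + ?g (int r + int s) x))"
    unfolding cheb_inner_def by (intro set_lebesgue_integral_cong) auto
  also have "\<dots> = c r * c s / 2 * ((if int r - int s = 0 then pi else 0)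
      + (if int r + int s = 0 then pi else 0))"
    by (simp only: set_integral_mult_right set_integral_add(2)[OF int int] integral_cos_arccos)
  finally have "cheb_inner (cheb_p r) (cheb_p s) = \<dots>" .
  \<comment> \<open>For \<open>r = s = 0\<close> both cosine integrals equal pi, for
    \<open>r = s > 0\<close> only that of the difference does; the smaller constant
    \<open>c 0\<close> compensates.\<close>
  moreover have "c r * c r = (if r = 0 then 1 / pi else 2 / pi)"
    by (simp add: c_def flip: power2_eq_square)
  ultimately show ?thesis
    by (cases "r = s"; cases "s = 0") auto
qed

section \<open>Orthogonality and positive norms of the bases\<close>

lemma vp_mu_pos: "0 < m \<Longrightarrow> r < N + m \<Longrightarrow> 0 < vp_mu N m r"
  by (simp add: vp_mu_def)

text \<open>The reflection \<open>2 * N - k\<close> moves the second Chebyshev index above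
  \<open>N\<close>, so distinct indices below \<open>N\<close> share no Chebyshev
  polynomial.\<close>

lemma Phi_orth_orthogonal:
  assumes "m < N" "k < N" "l < N" "k \<noteq> l"
  shows "cheb_inner (Phi_orth N m k) (Phi_orth N m l) = 0"
  using assms by (auto simp: Phi_orth_def cheb_inner_linear cheb_p_orthonormal)

text \<open>Beyond \<open>N - m\<close> the squared norm is a sum of two squared coefficients, the
  first of them nonzero. Positivity justifies the divisions in the matrices.\<close>

lemma nu_pos:
  assumes "0 < m" "m < N" "k < N"
  shows "0 < nu N m k"
proof (cases "k \<le> N - m")
  case False
  have "0 < vp_mu N m k * vp_mu N m k"
    using assms vp_mu_pos[of m k N] by simp
  moreover have "0 \<le> vp_mu N m (2 * N - k) * vp_mu N m (2 * N - k)"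
    by simp
  ultimately have "0 < vp_mu N m k * vp_mu N m k + vp_mu N m (2 * N - k) * vp_mu N m (2 * N - k)"
    by (rule add_pos_nonneg)
  then show ?thesis
    using False assms
    by (simp add: nu_def cheb_norm_sq_def Phi_orth_def cheb_inner_linear cheb_p_orthonormal)
qed (simp add: nu_def cheb_norm_sq_def Phi_orth_def cheb_p_orthonormal)

text \<open>The Chebyshev indices fall into three disjoint blocks: below \<open>n + m\<close> with
  reflection at \<open>n\<close>, the middle range without reflection, and above
  \<open>3 * n - m\<close> with reflection at \<open>3 * n\<close>. Ordering the two indices halves
  the cases.\<close>

lemma psi_orth_orthogonal_less:
  assumes "m < n" "n \<le> k" "k < l" "l < 3 * n"
  shows "cheb_inner (psi_orth n m k) (psi_orth n m l) = 0"
proof -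
  have kl: "k \<noteq> l" "2 * n - k \<noteq> l" "k \<noteq> 2 * n - l"
    using assms by linarith+
  consider "l < n + m" | "n + m \<le> l" "l \<le> 3 * n - m" | "3 * n - m < l"
    by linarith
  then show ?thesis
  proof cases
    case 1
    have "2 * n - k \<noteq> 2 * n - l" using assms 1 by linarith
    with 1 assms kl show ?thesis
      by (simp add: psi_orth_def cheb_inner_linear cheb_p_orthonormal)
  next
    case 2
    with assms kl show ?thesis
      by (simp add: psi_orth_def cheb_inner_linear cheb_p_orthonormal)
  next
    case 3
    show ?thesis
    proof (cases "k \<le> 3 * n - m")
      case True
      have "k \<noteq> 2 * (3 * n) - l" "2 * n - k \<noteq> 2 * (3 * n) - l" "\<not> l < n + m"
        using assms 3 True by linarith+
      with 3 True assms kl show ?thesis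
        by (simp add: psi_orth_def Phi_orth_def cheb_inner_linear cheb_p_orthonormal)
    next
      case False
      then have "\<not> k < n + m" "\<not> l < n + m"
        using assms by linarith+
      with False 3 assms Phi_orth_orthogonal[of m "3 * n" k l] show ?thesis
        by (simp add: psi_orth_def)
    qed
  qed
qed

lemma psi_orth_orthogonal:
  assumes "m < n" "n \<le> k" "k < 3 * n" "n \<le> l" "l < 3 * n" "k \<noteq> l"
  shows "cheb_inner (psi_orth n m k) (psi_orth n m l) = 0"
  using assms psi_orth_orthogonal_less[of m n k l] psi_orth_orthogonal_less[of m n l k]
    cheb_inner_commute
  by (metis linorder_neqE_nat)

lemma v_norm_pos:
  assumes "0 < m" "m < n" "n \<le> k" "k < 3 * n"
  shows "0 < v_norm n m k"
proof (cases "k < n + m")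
  case True
  have pos: "0 < vp_mu n m k" "0 < vp_mu n m (2 * n - k)"
    using assms True vp_mu_pos[of m _ n] by simp_all
  show ?thesis
  proof (cases "k = n")
    case True
    \<comment> \<open>Here \<open>2 * n - k\<close> equals \<open>k\<close>, so the two summands are
      merged before the norm is computed.\<close>
    then have "psi_orth n m k = Polynomial.smult (2 * vp_mu n m n) (cheb_p n)"
      using assms by (simp only: psi_orth_def mult_2 smult_add_left) simp
    with True pos show ?thesis
      by (simp add: v_norm_def cheb_norm_sq_def cheb_inner_linear cheb_p_orthonormal)
  next
    case False
    then have "2 * n - k \<noteq> k" using assms by linarith
    with True pos show ?thesis
      by (simp add: v_norm_def cheb_norm_sq_def psi_orth_def cheb_inner_linear cheb_p_orthonormal
          add_pos_pos)
  qed
next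
  case False
  with assms show ?thesis
    using nu_pos[of m "3 * n" k]
    by (simp add: v_norm_def cheb_norm_sq_def psi_orth_def nu_def cheb_p_orthonormal)
qed

text \<open>The Chebyshev expansions overlap only for \<open>n - m < k\<close> and \<open>l = 2n - k\<close>, where the two
  products of the values of \<^term>\<open>vp_mu n m\<close> at \<open>k\<close> and \<open>2n - k\<close> cancel.\<close>

lemma Phi_orth_psi_orth_orthogonal:
  assumes "m < n" "k < n" "n \<le> l" "l < 3 * n"
  shows "cheb_inner (Phi_orth n m k) (psi_orth n m l) = 0"
proof -
  consider "l < n + m" | "n + m \<le> l" "l \<le> 3 * n - m" | "3 * n - m < l"
    by linarith
  then show ?thesis
  proof cases
    case 1
    show ?thesis
    proof (cases "k \<le> n - m")
      case True
      then have "k \<noteq> 2 * n - l" "k \<noteq> l" using 1 assms by linarith+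
      with True 1 show ?thesis
        by (simp add: psi_orth_def Phi_orth_def cheb_inner_linear cheb_p_orthonormal)
    next
      case False
      show ?thesis
      proof (cases "l = 2 * n - k")
        case True
        then have "2 * n - l = k" "k \<noteq> l" using assms by linarith+
        with True False 1 show ?thesis
          by (simp add: psi_orth_def Phi_orth_def cheb_inner_linear cheb_p_orthonormal)
      next
        case neq: False
        then have "k \<noteq> 2 * n - l" "k \<noteq> l" "2 * n - k \<noteq> 2 * n - l" "2 * n - k \<noteq> l"
          using assms 1 by linarith+
        with False 1 show ?thesis
          by (simp add: psi_orth_def Phi_orth_def cheb_inner_linear cheb_p_orthonormal)
      qed
    qed
  next
    case 2
    have "k \<noteq> l" "\<not> l < n + m" "\<not> k \<le> n - m \<Longrightarrow> 2 * n - k \<noteq> l" using assms 2 by linarith+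
    with 2 show ?thesis
      by (simp add: psi_orth_def Phi_orth_def cheb_inner_linear cheb_p_orthonormal)
  next
    case 3
    have "k \<noteq> l" "k \<noteq> 2 * (3 * n) - l" "\<not> l < n + m" "2 * n - k \<noteq> 2 * (3 * n) - l"
      "\<not> k \<le> n - m \<Longrightarrow> 2 * n - k \<noteq> l"
      using assms 3 by linarith+
    with 3 show ?thesis
      by (simp add: psi_orth_def Phi_orth_def cheb_inner_linear cheb_p_orthonormal)
  qed
qed

section \<open>Projection onto the fine scale\<close>

lemma smult_sum_right: "Polynomial.smult c (sum f A) = (\<Sum>i\<in>A. Polynomial.smult c (f i))"
  by (induction A rule: infinite_finite_induct) (simp_all add: smult_add_right)

text \<open>For an orthogonal family of nonzero elements this is the orthogonal projection onto its
  span. By linearity the fixed points form a subspace, and being fixed is an expansion with explicit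
  coefficients.\<close>

definition Phi_proj :: "nat \<Rightarrow> nat \<Rightarrow> real poly \<Rightarrow> real poly" where
  "Phi_proj N m f = (\<Sum>j<N. Polynomial.smult (cheb_inner f (Phi_orth N m j) / nu N m j) (Phi_orth N m j))"

lemma Phi_proj_add: "Phi_proj N m (f + g) = Phi_proj N m f + Phi_proj N m g"
  by (simp add: Phi_proj_def cheb_inner_add_left add_divide_distrib smult_add_left sum.distrib)

lemma Phi_proj_smult: "Phi_proj N m (Polynomial.smult c f) = Polynomial.smult c (Phi_proj N m f)"
  by (simp add: Phi_proj_def cheb_inner_smult_left smult_sum_right)

lemma Phi_proj_diff: "Phi_proj N m (f - g) = Phi_proj N m f - Phi_proj N m g"
  using Phi_proj_add[of N m "f - g" g] by simp

lemma Phi_proj_Phi_orth: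
  assumes "0 < m" "m < N" "k < N"
  shows "Phi_proj N m (Phi_orth N m k) = Phi_orth N m k"
proof -
  have "Polynomial.smult (cheb_inner (Phi_orth N m k) (Phi_orth N m j) / nu N m j) (Phi_orth N m j)
      = (if j = k then Phi_orth N m k else 0)" if "j < N" for j
    using nu_pos[OF assms] Phi_orth_orthogonal[of m N k j] assms that
    by (auto simp: nu_def cheb_norm_sq_def)
  then show ?thesis
    using assms by (simp add: Phi_proj_def)
qed

lemma Phi_proj_cheb_p:
  assumes "0 < m" "m < N" "r \<le> N - m"
  shows "Phi_proj N m (cheb_p r) = cheb_p r"
  using Phi_proj_Phi_orth[of m N r] assms by (simp add: Phi_orth_def)

text \<open>The two coarse-level bases are concatenated in the row order of \<open>mat_M\<close>, so
  that one index covers both \<open>s_entry\<close> and \<open>w_entry\<close>.\<close>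

definition two_scale :: "nat \<Rightarrow> nat \<Rightarrow> nat \<Rightarrow> real poly" where
  "two_scale n m k = (if k < n then Phi_orth n m k else psi_orth n m k)"

text \<open>This is the two-scale inclusion on basis elements: up to \<open>3 * n - m\<close>
  linearity reduces it to single Chebyshev polynomials that are fine basis elements, and beyond that
  the element is itself a fine basis element.\<close>

lemma Phi_proj_two_scale:
  assumes "0 < m" "m < n" "k < 3 * n"
  shows "Phi_proj (3 * n) m (two_scale n m k) = two_scale n m k"
  using assms Phi_proj_Phi_orth[of m "3 * n" k]
  by (simp add: two_scale_def Phi_orth_def[of n] psi_orth_def Phi_proj_add Phi_proj_diff
      Phi_proj_smult Phi_proj_cheb_p)

lemma two_scale_orthogonal:
  assumes "m < n" "k < 3 * n" "l < 3 * n" "k \<noteq> l"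
  shows "cheb_inner (two_scale n m k) (two_scale n m l) = 0"
  using assms
    Phi_orth_orthogonal[of m n k l] psi_orth_orthogonal[of m n k l]
    Phi_orth_psi_orth_orthogonal[of m n k l] Phi_orth_psi_orth_orthogonal[of m n l k]
  by (auto simp: two_scale_def cheb_inner_commute[of "psi_orth n m k" "Phi_orth n m l"])

lemma cheb_norm_sq_two_scale:
  "cheb_norm_sq (two_scale n m k) = (if k < n then nu n m k else v_norm n m k)"
  by (simp add: two_scale_def nu_def v_norm_def)

lemma cheb_norm_sq_two_scale_pos:
  assumes "0 < m" "m < n" "k < 3 * n"
  shows "0 < cheb_norm_sq (two_scale n m k)"
  using assms nu_pos[of m n k] v_norm_pos[of m n k] by (simp add: cheb_norm_sq_two_scale)

section \<open>The matrices and their product\<close>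

lemma mat_M_index:
  assumes "k < 3 * n" "j < 3 * n"
  shows "mat_M n m $$ (k, j)
    = cheb_inner (two_scale n m k) (Phi_orth (3 * n) m j) / nu (3 * n) m j"
  using assms by (simp add: mat_M_def two_scale_def s_entry_def w_entry_def)

text \<open>The same inner products as in \<open>mat_M\<close>, transposed, but divided by the
  squared norms of the two-scale family instead of the fine one.\<close>

lemma mat_M_inv_index:
  assumes "k < 3 * n" "j < 3 * n"
  shows "mat_M_inv n m $$ (k, j)
    = cheb_inner (two_scale n m j) (Phi_orth (3 * n) m k) / cheb_norm_sq (two_scale n m j)"
  using assms
  by (simp add: mat_M_inv_def two_scale_def s_entry_def w_entry_def nu_def v_norm_def)

lemma mat_M_carrier: "mat_M n m \<in> carrier_mat (3 * n) (3 * n)"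
  by (simp add: mat_M_def)

lemma mat_M_inv_carrier: "mat_M_inv n m \<in> carrier_mat (3 * n) (3 * n)"
  by (simp add: mat_M_inv_def)

lemmas mat_M_dims [simp] = carrier_matD[OF mat_M_carrier] carrier_matD[OF mat_M_inv_carrier]

lemma two_scale_expansion:
  assumes "0 < m" "m < n" "k < 3 * n"
  shows "two_scale n m k = (\<Sum>j<3 * n. Polynomial.smult (mat_M n m $$ (k, j)) (Phi_orth (3 * n) m j))"
  using Phi_proj_two_scale[OF assms] assms by (simp add: Phi_proj_def mat_M_index)

lemma mat_M_mult_inv:
  assumes "0 < m" "m < n"
  shows "mat_M n m * mat_M_inv n m = 1\<^sub>m (3 * n)"
proof (rule eq_matI)
  fix k l assume "k < dim_row (1\<^sub>m (3 * n) :: real mat)" "l < dim_col (1\<^sub>m (3 * n) :: real mat)"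
  then have kl: "k < 3 * n" "l < 3 * n" by simp_all
  let ?e = "two_scale n m"
  have "(mat_M n m * mat_M_inv n m) $$ (k, l)
      = (\<Sum>j<3 * n. mat_M n m $$ (k, j) * mat_M_inv n m $$ (j, l))"
    using kl by (simp add: scalar_prod_def atLeast0LessThan)
  also have "\<dots> = (\<Sum>j<3 * n. mat_M n m $$ (k, j) * cheb_inner (Phi_orth (3 * n) m j) (?e l))
      / cheb_norm_sq (?e l)"
    using kl by (simp add: mat_M_inv_index cheb_inner_commute[of "?e l"] sum_divide_distrib)
  \<comment> \<open>By linearity the sum is the fine expansion of \<open>?e k\<close> paired with
    \<open>?e l\<close>.\<close>
  also have "\<dots> = cheb_inner (?e k) (?e l) / cheb_norm_sq (?e l)"
    by (subst two_scale_expansion[OF assms kl(1)])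
      (simp add: cheb_inner_sum_left cheb_inner_smult_left)
  also have "\<dots> = 1\<^sub>m (3 * n) $$ (k, l)"
    using kl two_scale_orthogonal[of m n k l] cheb_norm_sq_two_scale_pos[OF assms kl(1)] assms
    by (auto simp: cheb_norm_sq_def)
  finally show "(mat_M n m * mat_M_inv n m) $$ (k, l) = 1\<^sub>m (3 * n) $$ (k, l)" .
qed simp_all

text \<open>Pairing both expansions with the fine basis element at \<open>j\<close> isolates
  \<open>y j\<close>, because that element has nonzero norm.\<close>

lemma coeff_two_scale_to_Phi_orth:
  fixes x y :: "nat \<Rightarrow> real"
  assumes "0 < m" "m < n" "j < 3 * n"
    and eq: "(\<Sum>i<3 * n. Polynomial.smult (y i) (Phi_orth (3 * n) m i))
      = (\<Sum>k<3 * n. Polynomial.smult (x k) (two_scale n m k))"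
  shows "y j = (\<Sum>k<3 * n. x k * mat_M n m $$ (k, j))"
proof -
  let ?d = "Phi_orth (3 * n) m"
  have pos: "0 < nu (3 * n) m j" using assms by (intro nu_pos) auto
  have "y i * cheb_inner (?d i) (?d j) = (if i = j then y j * nu (3 * n) m j else 0)"
    if "i < 3 * n" for i
    using Phi_orth_orthogonal[of m "3 * n" i j] that assms by (auto simp: nu_def cheb_norm_sq_def)
  then have "y j * nu (3 * n) m j = cheb_inner (\<Sum>i<3 * n. Polynomial.smult (y i) (?d i)) (?d j)"
    using assms(3) by (simp add: cheb_inner_sum_left cheb_inner_smult_left)
  also have "\<dots> = (\<Sum>k<3 * n. x k * cheb_inner (two_scale n m k) (?d j))"
    unfolding eq by (simp add: cheb_inner_sum_left cheb_inner_smult_left)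
  finally have "y j = (\<Sum>k<3 * n. x k * cheb_inner (two_scale n m k) (?d j)) / nu (3 * n) m j"
    using pos by (simp add: field_simps)
  then show ?thesis
    using assms by (simp add: sum_divide_distrib mat_M_index)
qed

section \<open>The decomposition and reconstruction formulas\<close>

theorem theorem5p1:
  fixes n m :: nat
    and f fn g :: "real poly"
    and a b a3 :: "real vec"
  assumes "0 < m" and "m < n"
    and "f \<in> vp_V (3 * n) m" and "fn \<in> vp_V n m" and "g \<in> vp_W n m"
    and "f = fn + g"
    and "a \<in> carrier_vec n" and "b \<in> carrier_vec (2 * n)" and "a3 \<in> carrier_vec (3 * n)"
    and "fn = (\<Sum>k = 0..<n. Polynomial.smult (a $ k) (Phi_orth n m k))"
    and "g = (\<Sum>k = n..<3 * n. Polynomial.smult (b $ (k - n)) (psi_orth n m k))"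
    and "f = (\<Sum>j = 0..<3 * n. Polynomial.smult (a3 $ j) (Phi_orth (3 * n) m j))"
  shows "inverts_mat (mat_M n m) (mat_M_inv n m)
    \<and> inverts_mat (mat_M_inv n m) (mat_M n m)
    \<and> mat_of_row (a @\<^sub>v b) = mat_of_row a3 * mat_M_inv n m
    \<and> mat_of_row a3 = mat_of_row (a @\<^sub>v b) * mat_M n m"
proof -
  let ?M = "mat_M n m" and ?I = "mat_M_inv n m"
  have MI: "?M * ?I = 1\<^sub>m (3 * n)"
    using assms by (intro mat_M_mult_inv)
  have IM: "?I * ?M = 1\<^sub>m (3 * n)"
    using mat_mult_left_right_inverse[OF mat_M_carrier mat_M_inv_carrier MI] .
  have ab: "a @\<^sub>v b \<in> carrier_vec (3 * n)"
    using append_carrier_vec[OF assms(7,8)] by simp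
  have "(\<Sum>j<3 * n. Polynomial.smult (a3 $ j) (Phi_orth (3 * n) m j)) = fn + g"
    using assms by (simp add: atLeast0LessThan)
  also have "fn = (\<Sum>k = 0..<n. Polynomial.smult ((a @\<^sub>v b) $ k) (two_scale n m k))"
    using assms(7,8) by (simp add: \<open>fn = _\<close> two_scale_def)
  \<comment> \<open>From position \<open>n\<close> on, the concatenated vector reads
    \<open>b\<close> at \<open>k - n\<close>, which is the shift in the expansion of
    \<open>g\<close>.\<close>
  also have "g = (\<Sum>k = n..<3 * n. Polynomial.smult ((a @\<^sub>v b) $ k) (two_scale n m k))"
    using assms(7,8) by (simp add: \<open>g = _\<close> two_scale_def)
  also have "(\<Sum>k = 0..<n. Polynomial.smult ((a @\<^sub>v b) $ k) (two_scale n m k)) + \<dots>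
      = (\<Sum>k<3 * n. Polynomial.smult ((a @\<^sub>v b) $ k) (two_scale n m k))"
    by (simp add: sum.atLeastLessThan_concat atLeast0LessThan[symmetric])
  finally have coeff: "a3 $ j = (\<Sum>k<3 * n. (a @\<^sub>v b) $ k * ?M $$ (k, j))" if "j < 3 * n" for j
    using coeff_two_scale_to_Phi_orth[OF assms(1,2) that] by blast
  have rec: "mat_of_row a3 = mat_of_row (a @\<^sub>v b) * ?M"
  proof (rule eq_matI)
    fix i j assume "i < dim_row (mat_of_row (a @\<^sub>v b) * ?M)" "j < dim_col (mat_of_row (a @\<^sub>v b) * ?M)"
    then have "i = 0" "j < 3 * n" by auto
    then show "mat_of_row a3 $$ (i, j) = (mat_of_row (a @\<^sub>v b) * ?M) $$ (i, j)"
      using coeff assms(9) carrier_vecD[OF ab]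
      by (simp add: mat_of_row_index scalar_prod_def atLeast0LessThan)
  qed (use assms(9) in auto)
  \<comment> \<open>Decomposition follows from reconstruction on multiplying by the inverse from the
    right.\<close>
  have "mat_of_row a3 * ?I = mat_of_row (a @\<^sub>v b) * (?M * ?I)"
    unfolding rec using ab by (intro assoc_mult_mat[of _ 1 "3 * n" _ "3 * n" _ "3 * n"] mat_M_carrier mat_M_inv_carrier) auto
  also have "\<dots> = mat_of_row (a @\<^sub>v b)"
    unfolding MI using ab by (intro right_mult_one_mat[of _ 1]) auto
  finally show ?thesis
    using MI IM rec by (simp add: inverts_mat_def)
qed

end
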